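(* Let $k\ge 3$ and $n\ge 1$, and let $A$ be a set of $k$ alternatives. The class $\mathcal F_k(n)$ of all constitutions on $A$ with $n$ voters satisfying IIA and Transitivity consists exactly of all constitutions $F$ satisfying the following: there exists a partition of the set of alternatives $A$ into disjoint (nonempty) sets $A_1,\ldots,A_r$ such that (1) $A_1 >_F A_2 >_F \cdots >_F A_r$; (2) for all $A_s$ with $|A_s|\ge 3$, there exists a voter $j$ such that $F_{A_s}$ is a dictator on voter $j$; (3) for all $A_s$ with $|A_s|=2$, the constitution $F_{A_s}$ is an arbitrary non-constant function of the voters' preferences on the two alternatives in $A_s$.
   Context: A ranking (transitive preference) of $A$ is a strict linear order on $A$. A profile is an $n$-tuple $\sigma=(\sigma(1),\ldots,\sigma(n))$ of rankings, $\sigma(i)$ being the ranking of voter $i$. A constitution $F$ associates to every profile $\sigma$ and every pair of distinct alternatives $a,b$ a strict preference between $a$ and $b$ (the outcome $F(\sigma)$ need not be transitive). Transitivity: $F(\sigma)$ is transitive (i.e. is a ranking) for all $\sigma$. IIA: for every pair $a,b$, the preference of $F(\sigma)$ between $a$ and $b$ depends only on the relative rankings of $a$ and $b$ by all the voters. Dictator: $F$ is a dictator on voter $i$ if $F(\sigma)=\sigma(i)$ for all $\sigma$, or $F(\sigma)=-\sigma(i)$ for all $\sigma$, where $-\sigma(i)$ is the reverse of the ranking $\sigma(i)$. For sets of alternatives $A',B'$, $A' >_F B'$ means that for all $\sigma$, $F(\sigma)$ ranks all alternatives in $A'$ above all alternatives in $B'$. $F_{A'}$ denotes $F$ restricted to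 the alternatives in $A'$; "$F_{A'}$ is a dictator on voter $j$" means that the restriction of $F(\sigma)$ to $A'$ is, for all $\sigma$, the restriction of $\sigma(j)$ to $A'$, or is, for all $\sigma$, the reverse of that restriction. *)

theory Defs
  imports Main "HOL-Library.FuncSet" "HOL-Library.Disjoint_Sets"
begin

text \<open>
  Strict preferences on a set \<open>A\<close> of alternatives are relations: \<open>(a, b) \<in> r\<close> means that \<open>a\<close> is
  ranked above \<open>b\<close>. Profiles are indexed by \<open>{1..n}\<close>; profiles and constitutions are
  extensional functions, so that equality of functions is equality on their domain.
\<close>

text \<open>
  The library's \<open>strict_linear_order_on\<close> does not bound the field of the relation, hence the
  separate inclusion.
\<close>
definition rankings :: "'a set \<Rightarrow> 'a rel set" where
  "rankings A = {r. r \<subseteq> A \<times> A \<and> strict_linear_order_on A r}"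

text \<open>Exactly one strict preference for each pair of distinct alternatives, possibly cyclic.\<close>
definition tournaments :: "'a set \<Rightarrow> 'a rel set" where
  "tournaments A = {r. r \<subseteq> A \<times> A \<and> asym r \<and> total_on A r}"

definition profiles :: "nat \<Rightarrow> 'a set \<Rightarrow> (nat \<Rightarrow> 'a rel) set" where
  "profiles n A = {1..n} \<rightarrow>\<^sub>E rankings A"

definition constitutions :: "nat \<Rightarrow> 'a set \<Rightarrow> ((nat \<Rightarrow> 'a rel) \<Rightarrow> 'a rel) set" where
  "constitutions n A = profiles n A \<rightarrow>\<^sub>E tournaments A"

definition transitivity :: "nat \<Rightarrow> 'a set \<Rightarrow> ((nat \<Rightarrow> 'a rel) \<Rightarrow> 'a rel) \<Rightarrow> bool" where
  "transitivity n A F \<longleftrightarrow> (\<forall>\<sigma>\<in>profiles n A. F \<sigma> \<in> rankings A)"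

definition IIA :: "nat \<Rightarrow> 'a set \<Rightarrow> ((nat \<Rightarrow> 'a rel) \<Rightarrow> 'a rel) \<Rightarrow> bool" where
  "IIA n A F \<longleftrightarrow>
    (\<forall>a\<in>A. \<forall>b\<in>A. a \<noteq> b \<longrightarrow>
      (\<forall>\<sigma>\<in>profiles n A. \<forall>\<tau>\<in>profiles n A.
        (\<forall>i\<in>{1..n}. (a, b) \<in> \<sigma> i \<longleftrightarrow> (a, b) \<in> \<tau> i) \<longrightarrow>
        ((a, b) \<in> F \<sigma> \<longleftrightarrow> (a, b) \<in> F \<tau>)))"

definition arrow_class :: "nat \<Rightarrow> 'a set \<Rightarrow> ((nat \<Rightarrow> 'a rel) \<Rightarrow> 'a rel) set" where
  "arrow_class n A = {F \<in> constitutions n A. IIA n A F \<and> transitivity n A F}"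

definition always_above ::
    "nat \<Rightarrow> 'a set \<Rightarrow> ((nat \<Rightarrow> 'a rel) \<Rightarrow> 'a rel) \<Rightarrow> 'a set \<Rightarrow> 'a set \<Rightarrow> bool" where
  "always_above n A F B C \<longleftrightarrow> (\<forall>\<sigma>\<in>profiles n A. \<forall>b\<in>B. \<forall>c\<in>C. (b, c) \<in> F \<sigma>)"

definition dictator_on ::
    "nat \<Rightarrow> 'a set \<Rightarrow> ((nat \<Rightarrow> 'a rel) \<Rightarrow> 'a rel) \<Rightarrow> 'a set \<Rightarrow> nat \<Rightarrow> bool" where
  "dictator_on n A F S j \<longleftrightarrow>
    (\<forall>\<sigma>\<in>profiles n A. Restr (F \<sigma>) S = Restr (\<sigma> j) S) \<or>
    (\<forall>\<sigma>\<in>profiles n A. Restr (F \<sigma>) S = (Restr (\<sigma> j) S)\<inverse>)"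

text \<open>
  The restriction of \<open>F\<close> to \<open>S\<close> is a non-constant function \<open>G\<close> of the voters' preferences on \<open>S\<close>,
  i.e. a non-constant constitution on \<open>S\<close>.
\<close>
definition nonconstant_function_on ::
    "nat \<Rightarrow> 'a set \<Rightarrow> ((nat \<Rightarrow> 'a rel) \<Rightarrow> 'a rel) \<Rightarrow> 'a set \<Rightarrow> bool" where
  "nonconstant_function_on n A F S \<longleftrightarrow>
    (\<exists>G\<in>constitutions n S.
      (\<forall>\<sigma>\<in>profiles n A. Restr (F \<sigma>) S = G (\<lambda>i\<in>{1..n}. Restr (\<sigma> i) S)) \<and>
      (\<exists>\<rho>\<in>profiles n S. \<exists>\<rho>'\<in>profiles n S. G \<rho> \<noteq> G \<rho>'))"

text \<open>
  The list \<open>As\<close> is the ordered partition \<open>A\<^sub>1, \<dots>, A\<^sub>r\<close>. The chain \<open>A\<^sub>1 >\<^sub>F \<dots> >\<^sub>F A\<^sub>r\<close> is read as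
  \<open>A\<^sub>s >\<^sub>F A\<^sub>t\<close> for all \<open>s < t\<close>, which is what \<open>sorted_wrt\<close> says: the outcome of a constitution need
  not be transitive, so the relations between consecutive blocks would not imply the others.
\<close>
definition block_decomposition ::
    "nat \<Rightarrow> 'a set \<Rightarrow> ((nat \<Rightarrow> 'a rel) \<Rightarrow> 'a rel) \<Rightarrow> 'a set list \<Rightarrow> bool" where
  "block_decomposition n A F As \<longleftrightarrow>
    distinct As \<and> partition_on A (set As) \<and>
    sorted_wrt (always_above n A F) As \<and>
    (\<forall>S\<in>set As. card S \<ge> 3 \<longrightarrow> (\<exists>j\<in>{1..n}. dictator_on n A F S j)) \<and>
    (\<forall>S\<in>set As. card S = 2 \<longrightarrow> nonconstant_function_on n A F S)"

end

theory Submission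
  imports Defs
begin

text \<open>
  By IIA, the outcome between \<open>a\<close> and \<open>b\<close> is a function \<open>pair_rule a b\<close> of the set of voters that
  rank \<open>a\<close> above \<open>b\<close>. Three sets \<open>X\<close>, \<open>Y\<close>, \<open>Z\<close> of voters arise as the supporters of \<open>a\<close> over \<open>b\<close>,
  \<open>b\<close> over \<open>c\<close> and \<open>c\<close> over \<open>a\<close> in one profile exactly if no voter belongs to all three sets or to
  none of them: the only pattern that a single ranking cannot show is a cycle. Transitivity of the
  outcome therefore says that for such \<open>X\<close>, \<open>Y\<close>, \<open>Z\<close> the values \<open>pair_rule a b X\<close>,
  \<open>pair_rule b c Y\<close> and \<open>pair_rule c a Z\<close> are not all equal (\<open>pair_rule_acyclic\<close>).

  Call a pair contested if neither alternative always wins against the other. For any \<open>X\<close> and \<open>Y\<close>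
  there is a \<open>Z\<close> that completes them to an admissible triple. If \<open>c\<close> always won against \<open>a\<close> while
  \<open>a, b\<close> and \<open>b, c\<close> are contested, one could choose \<open>X\<close> and \<open>Y\<close> such that the outcome is cyclic. So
  being contested is an equivalence relation (\<open>equiv_contested\<close>). Its classes are the blocks, and
  always winning orders them linearly (\<open>blocks_comparable\<close>).

  If \<open>Y\<close> is the complement of \<open>X\<close>, then every \<open>Z\<close> completes the triple. If moreover \<open>c, a\<close> is contested,
  \<open>Z\<close> can be chosen with either value of \<open>pair_rule c a Z\<close>, so \<open>pair_rule b c\<close> of the complement of \<open>X\<close>
  differs from \<open>pair_rule a b X\<close>; in other words \<open>pair_rule a b = pair_rule c b\<close>. Hence in a block
  with at least three alternatives all pairs are decided by the same rule \<open>g\<close>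
  (\<open>pair_rule_neutral\<close>). The acyclicity condition on the single rule \<open>g\<close> forbids two different voters
  to be pivotal, so that \<open>g\<close> follows one voter or opposes one voter (\<open>acyclic_rule_one_voter\<close>).

  Conversely, in a block decomposition the outcome on a pair is constant across blocks and a function
  of the preferences on that pair within a block, which is IIA. A violation of transitivity would be a cycle of three
  distinct alternatives. The order of the blocks confines it to one block, which then has at least
  three alternatives and copies or reverses the transitive preference of its dictator.
\<close>

section \<open>Rankings and profiles\<close>

lemma rankings_subset_tournaments: "rankings A \<subseteq> tournaments A"
  unfolding rankings_def tournaments_def strict_linear_order_on_def
  by (auto simp: asym_on_def irrefl_def dest: transD)

lemma tournament_swap:
  assumes "r \<in> tournaments A" "a \<in> A" "b \<in> A" "a \<noteq> b"
  shows "(b, a) \<in> r \<longleftrightarrow> (a, b) \<notin> r"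
  using assms unfolding tournaments_def total_on_def by (auto dest: asymD)

lemmas ranking_swap = tournament_swap[OF subsetD[OF rankings_subset_tournaments]]

lemma tournament_irrefl: "r \<in> tournaments A \<Longrightarrow> (a, a) \<notin> r"
  unfolding tournaments_def by (auto dest: asymD)

lemmas ranking_irrefl = tournament_irrefl[OF subsetD[OF rankings_subset_tournaments]]

lemma rankings_trans: "r \<in> rankings A \<Longrightarrow> trans r"
  unfolding rankings_def strict_linear_order_on_def by blast

lemma transitive_tournament: "r \<in> tournaments A \<Longrightarrow> trans r \<Longrightarrow> r \<in> rankings A"
  unfolding rankings_def tournaments_def strict_linear_order_on_def
  by (auto simp: irrefl_def dest: asymD)

lemma Restr_tournament: "r \<in> tournaments A \<Longrightarrow> S \<subseteq> A \<Longrightarrow> Restr r S \<in> tournaments S"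
  unfolding tournaments_def total_on_def asym_on_def by (auto; metis subsetD)

lemma Restr_ranking: "r \<in> rankings A \<Longrightarrow> S \<subseteq> A \<Longrightarrow> Restr r S \<in> rankings S"
  using Restr_tournament rankings_subset_tournaments rankings_trans trans_Restr
    transitive_tournament by (metis subsetD)

lemma rankings_nonempty: "rankings A \<noteq> {}"
proof -
  obtain r where "well_order_on A r" using well_order_on by blast
  then have "linear_order_on A r" by (simp add: well_order_on_def)
  then have "r - Id \<in> rankings A"
    using strict_linear_order_on_diff_Id[of A r]
    by (auto simp: rankings_def order_on_defs refl_on_def)
  then show ?thesis by blast
qed

lemma rankings_append:
  assumes "r \<in> rankings S" "q \<in> rankings T" "S \<inter> T = {}"
  shows "r \<union> q \<union> S \<times> T \<in> rankings (S \<union> T)"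
proof -
  have sub: "r \<subseteq> S \<times> S" "q \<subseteq> T \<times> T" and "irrefl r" "irrefl q" "total_on S r" "total_on T q"
    and trans: "trans r" "trans q"
    using assms by (auto simp: rankings_def strict_linear_order_on_def)
  have "trans (r \<union> q \<union> S \<times> T)"
  proof (rule transI)
    fix x y z
    assume "(x, y) \<in> r \<union> q \<union> S \<times> T" "(y, z) \<in> r \<union> q \<union> S \<times> T"
    then show "(x, z) \<in> r \<union> q \<union> S \<times> T"
      using sub assms(3) transD[OF trans(1), of x y z] transD[OF trans(2), of x y z] by blast
  qed
  moreover have "irrefl (r \<union> q \<union> S \<times> T)"
    using \<open>irrefl r\<close> \<open>irrefl q\<close> assms(3) by (auto simp: irrefl_def)
  moreover have "total_on (S \<union> T) (r \<union> q \<union> S \<times> T)"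
    using \<open>total_on S r\<close> \<open>total_on T q\<close> by (auto simp: total_on_def)
  moreover have "r \<union> q \<union> S \<times> T \<subseteq> (S \<union> T) \<times> (S \<union> T)" using sub by blast
  ultimately show ?thesis by (simp add: rankings_def strict_linear_order_on_def)
qed

text \<open>
  The alternatives outside \<open>S\<close> are appended below those of \<open>S\<close>. This makes the domain of profiles
  rich enough: whatever the voters are to prefer on a few alternatives, some profile realises it.
\<close>

lemma ranking_extension:
  assumes "r \<in> rankings S" "S \<subseteq> A"
  shows "\<exists>q\<in>rankings A. Restr q S = r"
proof -
  obtain q where q: "q \<in> rankings (A - S)" using rankings_nonempty by blast
  have "r \<union> q \<union> S \<times> (A - S) \<in> rankings A"
    using rankings_append[OF assms(1) q] assms(2) by (simp add: Un_absorb1)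
  moreover have "Restr (r \<union> q \<union> S \<times> (A - S)) S = r"
    using assms(1) q by (auto simp: rankings_def)
  ultimately show ?thesis by blast
qed

lemma profile_extension:
  assumes "\<And>i. i \<in> {1..n} \<Longrightarrow> \<rho> i \<in> rankings S" "S \<subseteq> A"
  shows "\<exists>\<sigma>\<in>profiles n A. \<forall>i\<in>{1..n}. Restr (\<sigma> i) S = \<rho> i"
proof -
  have "\<forall>i\<in>{1..n}. \<exists>q. q \<in> rankings A \<and> Restr q S = \<rho> i"
    using ranking_extension[OF assms(1) assms(2)] by blast
  then obtain q where "\<forall>i\<in>{1..n}. q i \<in> rankings A \<and> Restr (q i) S = \<rho> i"
    by (auto simp: bchoice_iff)
  then show ?thesis
    by (intro bexI[of _ "restrict q {1..n}"]) (auto simp: profiles_def)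
qed

lemma profile_ranking: "\<sigma> \<in> profiles n A \<Longrightarrow> i \<in> {1..n} \<Longrightarrow> \<sigma> i \<in> rankings A"
  unfolding profiles_def by (auto simp: PiE_iff)

lemma profiles_nonempty: "profiles n A \<noteq> {}"
  using rankings_nonempty by (auto simp: profiles_def PiE_eq_empty_iff)

lemma profile_restrict:
  "\<sigma> \<in> profiles n A \<Longrightarrow> S \<subseteq> A \<Longrightarrow> (\<lambda>i\<in>{1..n}. Restr (\<sigma> i) S) \<in> profiles n S"
  using Restr_ranking[OF profile_ranking, of \<sigma> n A _ S]
  by (simp add: profiles_def[of n S] restrict_PiE_iff)

lemma two_chain: "a \<noteq> b \<Longrightarrow> {(a, b)} \<in> rankings {a, b}"
  by (auto simp: rankings_def strict_linear_order_on_def irrefl_def total_on_def intro!: transI)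

lemma three_chain:
  "distinct [a, b, c] \<Longrightarrow> {(a, b), (b, c), (a, c)} \<in> rankings {a, b, c}"
  by (auto simp: rankings_def strict_linear_order_on_def irrefl_def total_on_def intro!: transI)

text \<open>
  Of the eight ways to orient the triangle \<open>a\<close>, \<open>b\<close>, \<open>c\<close> only the two cyclic ones are not rankings.
\<close>

lemma ranking_of_triple:
  assumes "distinct [a, b, c]" "\<not> (x \<and> y \<and> z)" "x \<or> y \<or> z"
  shows "\<exists>r\<in>rankings {a, b, c}. ((a, b) \<in> r \<longleftrightarrow> x) \<and> ((b, c) \<in> r \<longleftrightarrow> y) \<and> ((c, a) \<in> r \<longleftrightarrow> z)"
proof -
  have chain: ?thesis
    if "distinct [p, q, s]" "{p, q, s} = {a, b, c}"
      and "(a, b) \<in> {(p, q), (q, s), (p, s)} \<longleftrightarrow> x" "(b, c) \<in> {(p, q), (q, s), (p, s)} \<longleftrightarrow> y"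
        "(c, a) \<in> {(p, q), (q, s), (p, s)} \<longleftrightarrow> z" for p q s
    using three_chain[OF that(1)] that(2-5) by (intro bexI[of _ "{(p, q), (q, s), (p, s)}"]) simp_all
  consider "x" "y" "\<not> z" | "\<not> x" "y" "z" | "x" "\<not> y" "z" | "x" "\<not> y" "\<not> z"
    | "\<not> x" "y" "\<not> z" | "\<not> x" "\<not> y" "z" using assms(2,3) by blast
  then show ?thesis
  proof cases
    case 1 with assms(1) show ?thesis by (intro chain[of a b c]) auto
  next
    case 2 with assms(1) show ?thesis by (intro chain[of b c a]) auto
  next
    case 3 with assms(1) show ?thesis by (intro chain[of c a b]) auto
  next
    case 4 with assms(1) show ?thesis by (intro chain[of a c b]) auto
  next
    case 5 with assms(1) show ?thesis by (intro chain[of b a c]) auto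
  next
    case 6 with assms(1) show ?thesis by (intro chain[of c b a]) auto
  qed
qed

definition supporters :: "nat \<Rightarrow> (nat \<Rightarrow> 'a rel) \<Rightarrow> 'a \<Rightarrow> 'a \<Rightarrow> nat set" where
  "supporters n \<sigma> a b = {i \<in> {1..n}. (a, b) \<in> \<sigma> i}"

lemma supporters_subset: "supporters n \<sigma> a b \<subseteq> {1..n}"
  unfolding supporters_def by blast

lemma supporters_swap:
  assumes "\<sigma> \<in> profiles n A" "a \<in> A" "b \<in> A" "a \<noteq> b"
  shows "supporters n \<sigma> b a = {1..n} - supporters n \<sigma> a b"
  using ranking_swap[OF profile_ranking[OF assms(1)] assms(2-4)]
  by (auto simp: supporters_def)

lemma profile_of_pair:
  assumes "a \<in> A" "b \<in> A" "a \<noteq> b" "X \<subseteq> {1..n}"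
  shows "\<exists>\<sigma>\<in>profiles n A. supporters n \<sigma> a b = X"
proof -
  define \<rho> where "\<rho> i = (if i \<in> X then {(a, b)} else {(b, a)})" for i
  have "\<rho> i \<in> rankings {a, b}" for i
    using two_chain[of a b] two_chain[of b a] assms(3) by (auto simp: \<rho>_def insert_commute)
  then obtain \<sigma> where \<sigma>: "\<sigma> \<in> profiles n A" "\<forall>i\<in>{1..n}. Restr (\<sigma> i) {a, b} = \<rho> i"
    using profile_extension[of n \<rho> "{a, b}" A] assms by auto
  have "(a, b) \<in> \<sigma> i \<longleftrightarrow> i \<in> X" if "i \<in> {1..n}" for i
  proof -
    have "(a, b) \<in> \<sigma> i \<longleftrightarrow> (a, b) \<in> Restr (\<sigma> i) {a, b}" by simp
    also have "\<dots> \<longleftrightarrow> i \<in> X" using \<sigma>(2) that assms(3) by (auto simp: \<rho>_def)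
    finally show ?thesis .
  qed
  then have "supporters n \<sigma> a b = X" using assms(4) by (auto simp: supporters_def)
  with \<sigma>(1) show ?thesis by blast
qed

lemma profile_of_triple:
  assumes "a \<in> A" "b \<in> A" "c \<in> A" "distinct [a, b, c]"
    and "X \<inter> Y \<inter> Z = {}" "X \<union> Y \<union> Z = {1..n}"
  shows "\<exists>\<sigma>\<in>profiles n A.
    supporters n \<sigma> a b = X \<and> supporters n \<sigma> b c = Y \<and> supporters n \<sigma> c a = Z"
proof -
  have "\<exists>r\<in>rankings {a, b, c}.
      ((a, b) \<in> r \<longleftrightarrow> i \<in> X) \<and> ((b, c) \<in> r \<longleftrightarrow> i \<in> Y) \<and> ((c, a) \<in> r \<longleftrightarrow> i \<in> Z)"
    if "i \<in> {1..n}" for i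
    using that assms(5,6) by (intro ranking_of_triple[OF assms(4)]) auto
  then obtain \<rho> where \<rho>: "\<And>i. i \<in> {1..n} \<Longrightarrow> \<rho> i \<in> rankings {a, b, c} \<and>
      ((a, b) \<in> \<rho> i \<longleftrightarrow> i \<in> X) \<and> ((b, c) \<in> \<rho> i \<longleftrightarrow> i \<in> Y) \<and> ((c, a) \<in> \<rho> i \<longleftrightarrow> i \<in> Z)"
    by metis
  obtain \<sigma> where \<sigma>: "\<sigma> \<in> profiles n A" "\<forall>i\<in>{1..n}. Restr (\<sigma> i) {a, b, c} = \<rho> i"
    using profile_extension[of n \<rho> "{a, b, c}" A] assms(1-3) \<rho> by auto
  have "((a, b) \<in> \<sigma> i \<longleftrightarrow> i \<in> X) \<and> ((b, c) \<in> \<sigma> i \<longleftrightarrow> i \<in> Y) \<and> ((c, a) \<in> \<sigma> i \<longleftrightarrow> i \<in> Z)"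
    if "i \<in> {1..n}" for i
    using \<rho>[OF that] bspec[OF \<sigma>(2) that] by (metis IntI Int_iff SigmaI insertI1 insertI2)
  moreover have "X \<subseteq> {1..n}" "Y \<subseteq> {1..n}" "Z \<subseteq> {1..n}" using assms(6) by auto
  ultimately have "supporters n \<sigma> a b = X \<and> supporters n \<sigma> b c = Y \<and> supporters n \<sigma> c a = Z"
    unfolding supporters_def by blast
  with \<sigma>(1) show ?thesis by blast
qed

section \<open>Voting rules without cycles\<close>

text \<open>
  The voters in \<open>E\<close> are added one at a time; none of these steps changes the value.
\<close>

lemma irrelevant_voters:
  assumes "finite E" "W \<union> E \<subseteq> N"
    and "\<And>j X. j \<in> E \<Longrightarrow> X \<subseteq> N \<Longrightarrow> g (insert j X) = g (X - {j})"
  shows "g (W \<union> E) = g W"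
  using assms
proof (induction E rule: finite_induct)
  case (insert j E)
  have "W \<union> E \<subseteq> N" using insert.prems(1) by blast
  have "g (W \<union> insert j E) = g (insert j (W \<union> E))" by simp
  also have "\<dots> = g (W \<union> E)"
  proof (cases "j \<in> W")
    case True
    then show ?thesis by (simp add: insert_absorb)
  next
    case False
    then have "W \<union> E - {j} = W \<union> E" using insert.hyps(2) by blast
    then show ?thesis using insert.prems(2)[of j "W \<union> E"] \<open>W \<union> E \<subseteq> N\<close> by simp
  qed
  also have "\<dots> = g W"
    using \<open>W \<union> E \<subseteq> N\<close> insert.prems(2) by (intro insert.IH) blast+
  finally show ?case .
qed simp

text \<open>
  The combinatorial core of Arrow's theorem. Taking \<open>Z = X\<close> and \<open>Y = N - X\<close> shows that \<open>g\<close> takes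
  opposite values on complements; in particular it is not constant, so some voter is pivotal. Two
  pivotal voters \<open>i \<noteq> j\<close> are impossible: given pivotal situations \<open>X\<close> for \<open>i\<close> and \<open>Y\<close> for \<open>j\<close>, there is
  one \<open>Z\<close> that is admissible whatever \<open>i\<close> does in \<open>X\<close> and \<open>j\<close> does in \<open>Y\<close>, and so both could align
  their outcome with \<open>g Z\<close>. Hence \<open>g\<close> depends on one voter only.
\<close>

lemma acyclic_rule_one_voter:
  fixes g :: "'v set \<Rightarrow> bool"
  assumes "finite N"
    and acyclic: "\<And>X Y Z. X \<inter> Y \<inter> Z = {} \<Longrightarrow> X \<union> Y \<union> Z = N \<Longrightarrow> \<not> (g X = g Y \<and> g Y = g Z)"
  shows "\<exists>i\<in>N. (\<forall>X\<subseteq>N. g X \<longleftrightarrow> i \<in> X) \<or> (\<forall>X\<subseteq>N. g X \<longleftrightarrow> i \<notin> X)"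
proof -
  define pivotal where "pivotal i \<longleftrightarrow> i \<in> N \<and> (\<exists>X\<subseteq>N. g (insert i X) \<noteq> g (X - {i}))" for i
  have g_empty: "g {} \<noteq> g N" using acyclic[of "{}" N "{}"] by auto
  have "\<exists>i. pivotal i"
  proof (rule ccontr)
    assume "\<nexists>i. pivotal i"
    then have "g ({} \<union> N) = g {}"
      using \<open>finite N\<close> by (intro irrelevant_voters[of N "{}" N]) (simp, simp, metis pivotal_def)
    then show False using g_empty by simp
  qed
  then obtain i where i: "pivotal i" by blast
  have unique: "j = i" if "pivotal j" for j
  proof (rule ccontr)
    assume "j \<noteq> i"
    obtain X where X: "X \<subseteq> N" "g (insert i X) \<noteq> g (X - {i})"
      using i by (auto simp: pivotal_def)
    obtain Y where Y: "Y \<subseteq> N" "g (insert j Y) \<noteq> g (Y - {j})"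
      using \<open>pivotal j\<close> by (auto simp: pivotal_def)
    have N: "i \<in> N" "j \<in> N" using i \<open>pivotal j\<close> by (auto simp: pivotal_def)
    \<comment> \<open>Voter \<open>i\<close> may switch in \<open>X\<close>, so at \<open>i\<close> the set \<open>Z\<close> has to differ from \<open>Y\<close>; likewise at \<open>j\<close> from \<open>X\<close>.\<close>
    define Z where "Z = {v \<in> N. if v = i then v \<notin> Y else if v = j then v \<notin> X else \<not> (v \<in> X \<and> v \<in> Y)}"
    obtain X' where X': "X' \<in> {insert i X, X - {i}}" "g X' = g Z"
      using X(2) by (cases "g (insert i X) = g Z") auto
    obtain Y' where Y': "Y' \<in> {insert j Y, Y - {j}}" "g Y' = g Z"
      using Y(2) by (cases "g (insert j Y) = g Z") auto
    have mem: "v \<in> X' \<longleftrightarrow> v \<in> X" if "v \<noteq> i" for v using X'(1) that by auto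
    have mem': "v \<in> Y' \<longleftrightarrow> v \<in> Y" if "v \<noteq> j" for v using Y'(1) that by auto
    have sub: "X' \<subseteq> N" "Y' \<subseteq> N" "Z \<subseteq> N" using X'(1) Y'(1) X(1) Y(1) N by (auto simp: Z_def)
    have v: "\<not> (v \<in> X' \<and> v \<in> Y' \<and> v \<in> Z) \<and> (v \<in> X' \<or> v \<in> Y' \<or> v \<in> Z)" if "v \<in> N" for v
      using mem[of v] mem'[of v] that \<open>j \<noteq> i\<close>
      by (cases "v = i"; cases "v = j") (auto simp: Z_def)
    have "X' \<inter> Y' \<inter> Z = {}" using v sub by blast
    moreover have "X' \<union> Y' \<union> Z = N" using v sub by blast
    ultimately show False using acyclic[of X' Y' Z] X'(2) Y'(2) by simp
  qed
  have only_i: "g X = g (X \<inter> {i})" if "X \<subseteq> N" for X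
  proof -
    have "g (X \<inter> {i} \<union> (X - {i})) = g (X \<inter> {i})"
    proof (rule irrelevant_voters)
      show "finite (X - {i})" using that \<open>finite N\<close> finite_subset by blast
      show "X \<inter> {i} \<union> (X - {i}) \<subseteq> N" using that by blast
      show "g (insert j Y) = g (Y - {j})" if "j \<in> X - {i}" "Y \<subseteq> N" for j Y
        using unique[of j] that \<open>X \<subseteq> N\<close> unfolding pivotal_def by blast
    qed
    then show ?thesis by (simp add: Int_Diff_Un)
  qed
  have "g N = g {i}" using only_i[of N] i by (simp add: pivotal_def)
  then have *: "g X \<longleftrightarrow> (i \<in> X \<longleftrightarrow> g N)" if "X \<subseteq> N" for X
    using only_i[OF that] g_empty by (cases "i \<in> X") simp_all
  have "i \<in> N" using i by (simp add: pivotal_def)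
  then show ?thesis
  proof (rule rev_bexI)
    show "(\<forall>X\<subseteq>N. g X \<longleftrightarrow> i \<in> X) \<or> (\<forall>X\<subseteq>N. g X \<longleftrightarrow> i \<notin> X)"
      using * by (cases "g N") metis+
  qed
qed

section \<open>Transitive constitutions with independence of irrelevant alternatives\<close>

locale arrow_constitution =
  fixes n :: nat and A :: "'a set" and F :: "(nat \<Rightarrow> 'a rel) \<Rightarrow> 'a rel"
  assumes arrow: "F \<in> arrow_class n A"
begin

lemma F_IIA: "IIA n A F"
  and F_ranking: "\<sigma> \<in> profiles n A \<Longrightarrow> F \<sigma> \<in> rankings A"
  using arrow by (auto simp: arrow_class_def transitivity_def)

lemma F_tournament: "\<sigma> \<in> profiles n A \<Longrightarrow> F \<sigma> \<in> tournaments A"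
  using F_ranking rankings_subset_tournaments by blast

text \<open>
  IIA makes the choice of the profile immaterial, see \<open>outcome_pair_rule\<close>. Sets that are not the
  supporters of any profile are mapped to \<open>False\<close>.
\<close>

definition pair_rule :: "'a \<Rightarrow> 'a \<Rightarrow> nat set \<Rightarrow> bool" where
  "pair_rule a b X \<longleftrightarrow> (\<exists>\<sigma>\<in>profiles n A. supporters n \<sigma> a b = X \<and> (a, b) \<in> F \<sigma>)"

lemma outcome_pair_rule:
  assumes "\<sigma> \<in> profiles n A" "a \<in> A" "b \<in> A" "a \<noteq> b"
  shows "(a, b) \<in> F \<sigma> \<longleftrightarrow> pair_rule a b (supporters n \<sigma> a b)"
proof -
  have "(a, b) \<in> F \<sigma>"
    if "\<tau> \<in> profiles n A" "supporters n \<tau> a b = supporters n \<sigma> a b" "(a, b) \<in> F \<tau>" for \<tau>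
  proof -
    have "\<forall>i\<in>{1..n}. (a, b) \<in> \<tau> i \<longleftrightarrow> (a, b) \<in> \<sigma> i"
      using that(2) unfolding supporters_def by blast
    then show ?thesis using F_IIA assms that(1,3) unfolding IIA_def by blast
  qed
  then show ?thesis using assms(1) by (auto simp: pair_rule_def)
qed

text \<open>
  The three sets are realised by one profile, whose outcome contains neither of the two cycles on
  \<open>a\<close>, \<open>b\<close>, \<open>c\<close>.
\<close>

lemma pair_rule_acyclic:
  assumes "a \<in> A" "b \<in> A" "c \<in> A" "distinct [a, b, c]"
    and "X \<inter> Y \<inter> Z = {}" "X \<union> Y \<union> Z = {1..n}"
  shows "\<not> (pair_rule a b X = pair_rule b c Y \<and> pair_rule b c Y = pair_rule c a Z)"
proof -
  obtain \<sigma> where \<sigma>: "\<sigma> \<in> profiles n A"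
    "supporters n \<sigma> a b = X" "supporters n \<sigma> b c = Y" "supporters n \<sigma> c a = Z"
    using profile_of_triple[OF assms] by blast
  note r = F_ranking[OF \<sigma>(1)]
  have "(a, b) \<in> F \<sigma> \<longleftrightarrow> pair_rule a b X" "(b, c) \<in> F \<sigma> \<longleftrightarrow> pair_rule b c Y"
    "(c, a) \<in> F \<sigma> \<longleftrightarrow> pair_rule c a Z"
    using outcome_pair_rule[OF \<sigma>(1)] assms(1-4) \<sigma>(2-4) by auto
  moreover have "\<not> ((a, b) \<in> F \<sigma> \<and> (b, c) \<in> F \<sigma> \<and> (c, a) \<in> F \<sigma>)"
    using ranking_swap[OF r, of a c] rankings_trans[OF r] assms(1-4) by (auto dest: transD)
  moreover have "\<not> ((b, a) \<in> F \<sigma> \<and> (c, b) \<in> F \<sigma> \<and> (a, c) \<in> F \<sigma>)"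
    using ranking_swap[OF r, of a c] rankings_trans[OF r] assms(1-4) by (auto dest: transD)
  ultimately show ?thesis
    using ranking_swap[OF r, of a b] ranking_swap[OF r, of b c] ranking_swap[OF r, of c a] assms(1-4)
    by auto
qed

lemma pair_rule_swap:
  assumes "a \<in> A" "b \<in> A" "a \<noteq> b" "X \<subseteq> {1..n}"
  shows "pair_rule b a ({1..n} - X) \<longleftrightarrow> \<not> pair_rule a b X"
proof -
  obtain \<sigma> where \<sigma>: "\<sigma> \<in> profiles n A" "supporters n \<sigma> a b = X"
    using profile_of_pair[OF assms] by blast
  then show ?thesis
    using outcome_pair_rule[OF \<sigma>(1), of a b] outcome_pair_rule[OF \<sigma>(1), of b a]
      supporters_swap[OF \<sigma>(1), of a b] ranking_swap[OF F_ranking[OF \<sigma>(1)], of a b] assms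
    by auto
qed

subsection \<open>The block structure\<close>

abbreviation beats :: "'a \<Rightarrow> 'a \<Rightarrow> bool" where
  "beats a b \<equiv> always_above n A F {a} {b}"

text \<open>
  For \<open>a \<noteq> b\<close> this means that the rule for \<open>a\<close> against \<open>b\<close> is not constant. No alternative beats
  itself, so the diagonal of \<open>A\<close> is included.
\<close>

definition contested :: "'a rel" where
  "contested = {(a, b). a \<in> A \<and> b \<in> A \<and> \<not> beats a b \<and> \<not> beats b a}"

lemma always_above_trans:
  assumes "always_above n A F S T" "always_above n A F T U" "T \<noteq> {}"
  shows "always_above n A F S U"
  unfolding always_above_def
proof (intro ballI)
  fix \<sigma> s u
  assume *: "\<sigma> \<in> profiles n A" "s \<in> S" "u \<in> U"
  obtain t where "t \<in> T" using assms(3) by blast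
  then have "(s, t) \<in> F \<sigma>" "(t, u) \<in> F \<sigma>" using assms(1,2) * by (auto simp: always_above_def)
  then show "(s, u) \<in> F \<sigma>" by (rule transD[OF rankings_trans[OF F_ranking[OF *(1)]]])
qed

lemma beats_trans: "beats a b \<Longrightarrow> beats b c \<Longrightarrow> beats a c"
  by (erule always_above_trans) simp_all

lemma not_beats_self: "\<not> beats a a"
proof -
  obtain \<sigma> where "\<sigma> \<in> profiles n A" using profiles_nonempty by blast
  then show ?thesis using tournament_irrefl[OF F_tournament] by (auto simp: always_above_def)
qed

lemma contested_rule_takes:
  assumes "(a, b) \<in> contested" "a \<noteq> b"
  shows "\<exists>X\<subseteq>{1..n}. pair_rule a b X = v"
proof -
  have ab: "a \<in> A" "b \<in> A" using assms(1) by (auto simp: contested_def)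
  obtain \<sigma> \<tau> where \<sigma>: "\<sigma> \<in> profiles n A" "(a, b) \<notin> F \<sigma>" and \<tau>: "\<tau> \<in> profiles n A" "(b, a) \<notin> F \<tau>"
    using assms(1) by (auto simp: contested_def always_above_def)
  have "(a, b) \<in> F \<tau>" using ranking_swap[OF F_ranking[OF \<tau>(1)] ab assms(2)] \<tau>(2) by blast
  then have "pair_rule a b (supporters n (if v then \<tau> else \<sigma>) a b) = v"
    using outcome_pair_rule[OF \<sigma>(1) ab assms(2)] outcome_pair_rule[OF \<tau>(1) ab assms(2)] \<sigma>(2)
    by simp
  moreover have "supporters n (if v then \<tau> else \<sigma>) a b \<subseteq> {1..n}" by (rule supporters_subset)
  ultimately show ?thesis by (intro exI conjI)
qed

lemma contested_sym: "(a, b) \<in> contested \<Longrightarrow> (b, a) \<in> contested"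
  unfolding contested_def by blast

lemma beats_rule:
  assumes "a \<in> A" "b \<in> A" "a \<noteq> b" "X \<subseteq> {1..n}" "beats a b"
  shows "pair_rule a b X"
  using profile_of_pair[OF assms(1-4)] assms(5) by (auto simp: pair_rule_def always_above_def)

text \<open>
  The complement of \<open>X \<inter> Y\<close> completes any \<open>X\<close> and \<open>Y\<close> to an admissible triple. With \<open>X\<close> and \<open>Y\<close>
  chosen such that \<open>a\<close> wins against \<open>b\<close> and \<open>b\<close> against \<open>c\<close>, a sure win of \<open>c\<close> against \<open>a\<close> would close
  a cycle.
\<close>

lemma not_beats_across:
  assumes "(a, b) \<in> contested" "(b, c) \<in> contested"
  shows "\<not> beats c a"
proof
  assume "beats c a"
  have A: "a \<in> A" "b \<in> A" "c \<in> A" using assms by (auto simp: contested_def)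
  have d: "distinct [a, b, c]"
    using \<open>beats c a\<close> assms not_beats_self by (auto simp: contested_def)
  obtain X where X: "X \<subseteq> {1..n}" "pair_rule a b X"
    using contested_rule_takes[OF assms(1), of True] d by auto
  obtain Y where Y: "Y \<subseteq> {1..n}" "pair_rule b c Y"
    using contested_rule_takes[OF assms(2), of True] d by auto
  have "pair_rule c a ({1..n} - X \<inter> Y)"
    using beats_rule[of c a] A d \<open>beats c a\<close> by auto
  moreover have "X \<inter> Y \<inter> ({1..n} - X \<inter> Y) = {}" "X \<union> Y \<union> ({1..n} - X \<inter> Y) = {1..n}"
    using X(1) Y(1) by auto
  ultimately show False using pair_rule_acyclic[OF A d] X(2) Y(2) by meson
qed

lemma contested_trans: "(a, b) \<in> contested \<Longrightarrow> (b, c) \<in> contested \<Longrightarrow> (a, c) \<in> contested"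
  using not_beats_across[of a b c] not_beats_across[of c b a] contested_sym
  by (auto simp: contested_def)

lemma equiv_contested: "equiv A contested"
proof (rule equivI)
  show "contested \<subseteq> A \<times> A" by (auto simp: contested_def)
  show "refl_on A contested" using not_beats_self by (auto simp: refl_on_def contested_def)
  show "sym contested" using contested_sym by (rule symI)
  show "trans contested" using contested_trans by (rule transI)
qed

text \<open>
  If \<open>c\<close> beat \<open>a'\<close>, then \<open>a\<close> would beat \<open>a'\<close> by transitivity; if \<open>a', c\<close> were contested, then so would
  be \<open>a, c\<close>.
\<close>

lemma beats_contested_left:
  assumes "beats a c" "(a, a') \<in> contested" "c \<in> A"
  shows "beats a' c"
proof (rule ccontr)
  assume "\<not> beats a' c"
  moreover have "\<not> beats c a'"
    using beats_trans[OF assms(1)] assms(2) by (auto simp: contested_def)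
  ultimately have "(a', c) \<in> contested" using assms(2,3) by (auto simp: contested_def)
  then have "(a, c) \<in> contested" using contested_trans assms(2) by blast
  then show False using assms(1) by (simp add: contested_def)
qed

lemma beats_contested_right:
  assumes "beats a c" "(c, c') \<in> contested" "a \<in> A"
  shows "beats a c'"
proof (rule ccontr)
  assume "\<not> beats a c'"
  moreover have "\<not> beats c' a"
    using beats_trans[of c' a c] assms(1,2) by (auto simp: contested_def)
  ultimately have "(a, c') \<in> contested" using assms(2,3) by (auto simp: contested_def)
  then have "(a, c) \<in> contested" using contested_trans contested_sym assms(2) by blast
  then show False using assms(1) by (simp add: contested_def)
qed

text \<open>
  One of two representatives beats the other, and this spreads to the whole blocks.
\<close>

lemma blocks_comparable:
  assumes "S \<in> A // contested" "T \<in> A // contested" "S \<noteq> T"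
  shows "always_above n A F S T \<or> always_above n A F T S"
proof -
  obtain s where s: "s \<in> A" "S = contested `` {s}" using assms(1) by (rule quotientE)
  obtain t where t: "t \<in> A" "T = contested `` {t}" using assms(2) by (rule quotientE)
  have above: "always_above n A F (contested `` {p}) (contested `` {q})"
    if "p \<in> A" "q \<in> A" "beats p q" for p q
  proof -
    have "beats p' q'" if p': "(p, p') \<in> contested" and q': "(q, q') \<in> contested" for p' q'
    proof -
      have "p' \<in> A" using p' by (simp add: contested_def)
      have "beats p' q" using beats_contested_left[OF \<open>beats p q\<close> p' \<open>q \<in> A\<close>] .
      then show ?thesis using q' \<open>p' \<in> A\<close> by (rule beats_contested_right)
    qed
    then show ?thesis by (auto simp: always_above_def)
  qed
  have "(s, t) \<notin> contested"
    using assms(3) unfolding s(2) t(2) using equiv_class_eq[OF equiv_contested, of s t] by blast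
  then have "beats s t \<or> beats t s" using s(1) t(1) by (simp add: contested_def)
  then show ?thesis unfolding s(2) t(2) using above s(1) t(1) by metis
qed

subsection \<open>Blocks with at least three alternatives\<close>

text \<open>
  Every voter is in exactly one of \<open>X\<close> and its complement, so any \<open>Z\<close> completes these two sets to an
  admissible triple. As \<open>c, a\<close> is contested, \<open>Z\<close> can be chosen with either outcome, and it would close
  a cycle if \<open>a, b\<close> at \<open>X\<close> had the same outcome as \<open>b, c\<close> at the complement of \<open>X\<close>.
\<close>

lemma pair_rule_replace_first:
  assumes "b \<in> A" "(a, c) \<in> contested" "distinct [a, b, c]" "X \<subseteq> {1..n}"
  shows "pair_rule a b X = pair_rule c b X"
proof (rule ccontr)
  assume neq: "pair_rule a b X \<noteq> pair_rule c b X"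
  have A: "a \<in> A" "b \<in> A" "c \<in> A" using assms by (auto simp: contested_def)
  have eq: "pair_rule b c ({1..n} - X) = pair_rule a b X"
    using pair_rule_swap[of c b X] A assms(3,4) neq by auto
  obtain Z where "Z \<subseteq> {1..n}" "pair_rule c a Z = pair_rule a b X"
    using contested_rule_takes[OF contested_sym[OF assms(2)], of "pair_rule a b X"] assms(3) by auto
  moreover from this have "X \<inter> ({1..n} - X) \<inter> Z = {}" "X \<union> ({1..n} - X) \<union> Z = {1..n}"
    using assms(4) by auto
  ultimately show False using pair_rule_acyclic[OF A assms(3)] eq by metis
qed

lemma pair_rule_replace_second:
  assumes "a \<in> A" "(b, c) \<in> contested" "distinct [a, b, c]" "X \<subseteq> {1..n}"
  shows "pair_rule a b X = pair_rule a c X"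
proof -
  have A: "b \<in> A" "c \<in> A" using assms by (auto simp: contested_def)
  have "pair_rule b a ({1..n} - X) = pair_rule c a ({1..n} - X)"
    using assms(1-3) by (intro pair_rule_replace_first) auto
  then show ?thesis using pair_rule_swap[of a b X] pair_rule_swap[of a c X] A assms by auto
qed

lemma block_pair:
  assumes "S \<in> A // contested" "a \<in> S" "b \<in> S"
  shows "(a, b) \<in> contested"
  using quotient_eq_iff[OF equiv_contested assms(1,1,2,3)] by simp

text \<open>
  Any two ordered pairs are connected by replacing one alternative at a time. To reverse a pair,
  \<open>(a, b) \<leadsto> (e, b) \<leadsto> (e, a) \<leadsto> (b, a)\<close>, a third alternative \<open>e\<close> of the block is needed. This is where
  the size of the block enters, and why two-element blocks escape dictatorship.
\<close>

lemma pair_rule_neutral: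
  assumes S: "S \<in> A // contested" "card S \<ge> 3"
    and ab: "a \<in> S" "b \<in> S" "a \<noteq> b" and cd: "c \<in> S" "d \<in> S" "c \<noteq> d" and X: "X \<subseteq> {1..n}"
  shows "pair_rule a b X = pair_rule c d X"
proof -
  note contested = block_pair[OF S(1)]
  have "S \<subseteq> A" using contested by (auto simp: contested_def)
  have first: "pair_rule p q X = pair_rule p' q X"
    if "p \<in> S" "q \<in> S" "p' \<in> S" "p \<noteq> q" "p' \<noteq> q" for p q p'
    using pair_rule_replace_first[of q p p' X] contested that \<open>S \<subseteq> A\<close> X by (cases "p = p'") auto
  have second: "pair_rule p q X = pair_rule p q' X"
    if "p \<in> S" "q \<in> S" "q' \<in> S" "p \<noteq> q" "p \<noteq> q'" for p q q'
    using pair_rule_replace_second[of p q q' X] contested that \<open>S \<subseteq> A\<close> X by (cases "q = q'") auto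
  show ?thesis
  proof (cases "d = a")
    case False
    then show ?thesis using second[of a b d] first[of a d c] ab cd by blast
  next
    case True
    have "\<not> S \<subseteq> {a, b}"
      using S(2) card_mono[of "{a, b}" S] by (auto simp: card_insert_if split: if_splits)
    then obtain e where e: "e \<in> S" "e \<noteq> a" "e \<noteq> b" by blast
    have "pair_rule a b X = pair_rule e b X" using first ab e by blast
    also have "\<dots> = pair_rule e a X" using second ab e by blast
    also have "\<dots> = pair_rule c a X" using first ab cd e True by blast
    finally show ?thesis using True by simp
  qed
qed

lemma large_block_dictator:
  assumes S: "S \<in> A // contested" "card S \<ge> 3"
  shows "\<exists>j\<in>{1..n}. dictator_on n A F S j"
proof -
  have "S \<subseteq> A" using block_pair[OF S(1)] by (auto simp: contested_def)
  obtain B where "B \<subseteq> S" "card B = 3" using obtain_subset_with_card_n[OF S(2)] by blast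
  then obtain a b c where abc: "a \<in> S" "b \<in> S" "c \<in> S" "distinct [a, b, c]"
    unfolding card_3_iff by auto
  define g where "g = pair_rule a b"
  have g: "pair_rule p q X = g X" if "p \<in> S" "q \<in> S" "p \<noteq> q" "X \<subseteq> {1..n}" for p q X
    unfolding g_def using pair_rule_neutral[OF S, of p q a b X] that abc by auto
  have "\<not> (g X = g Y \<and> g Y = g Z)" if "X \<inter> Y \<inter> Z = {}" "X \<union> Y \<union> Z = {1..n}" for X Y Z
  proof -
    have "X \<subseteq> {1..n}" "Y \<subseteq> {1..n}" "Z \<subseteq> {1..n}" using that(2) by auto
    then have "pair_rule a b X = g X" "pair_rule b c Y = g Y" "pair_rule c a Z = g Z"
      using abc by (auto simp: g)
    moreover have "a \<in> A" "b \<in> A" "c \<in> A" using abc(1-3) \<open>S \<subseteq> A\<close> by auto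
    ultimately show ?thesis using pair_rule_acyclic[OF _ _ _ abc(4) that] by simp
  qed
  then obtain j where j: "j \<in> {1..n}"
    and "(\<forall>X\<subseteq>{1..n}. g X \<longleftrightarrow> j \<in> X) \<or> (\<forall>X\<subseteq>{1..n}. g X \<longleftrightarrow> j \<notin> X)"
    using acyclic_rule_one_voter[of "{1..n}" g] by auto
  then consider "\<And>X. X \<subseteq> {1..n} \<Longrightarrow> g X \<longleftrightarrow> j \<in> X" | "\<And>X. X \<subseteq> {1..n} \<Longrightarrow> g X \<longleftrightarrow> j \<notin> X"
    by blast
  note cases = this
  have outcome: "(p, q) \<in> F \<sigma> \<longleftrightarrow> g (supporters n \<sigma> p q)"
    if "\<sigma> \<in> profiles n A" "p \<in> S" "q \<in> S" "p \<noteq> q" for \<sigma> p q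
  proof -
    have "p \<in> A" "q \<in> A" using that(2,3) \<open>S \<subseteq> A\<close> by auto
    then show ?thesis
      using outcome_pair_rule[OF that(1)] g[OF that(2-4) supporters_subset] that(4) by simp
  qed
  have irr: "(p, p) \<notin> F \<sigma>" "(p, p) \<notin> \<sigma> j" if "\<sigma> \<in> profiles n A" for \<sigma> p
    using ranking_irrefl[OF F_ranking[OF that]] ranking_irrefl[OF profile_ranking[OF that j]]
    by simp_all
  have mem: "j \<in> supporters n \<sigma> p q \<longleftrightarrow> (p, q) \<in> \<sigma> j" for \<sigma> p q
    using j by (auto simp: supporters_def)
  from cases have "dictator_on n A F S j"
  proof cases
    case 1
    have "(p, q) \<in> F \<sigma> \<longleftrightarrow> (p, q) \<in> \<sigma> j" if "\<sigma> \<in> profiles n A" "p \<in> S" "q \<in> S" for \<sigma> p q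
      using outcome[OF that] irr[OF that(1)] mem[of \<sigma> p q] 1[OF supporters_subset[of n \<sigma> p q]]
      by (cases "p = q") simp_all
    then have "\<forall>\<sigma>\<in>profiles n A. Restr (F \<sigma>) S = Restr (\<sigma> j) S" by auto
    then show ?thesis unfolding dictator_on_def by blast
  next
    case 2
    have "(p, q) \<in> F \<sigma> \<longleftrightarrow> (q, p) \<in> \<sigma> j" if "\<sigma> \<in> profiles n A" "p \<in> S" "q \<in> S" for \<sigma> p q
    proof (cases "p = q")
      case True
      then show ?thesis using irr[OF that(1)] by simp
    next
      case False
      have "p \<in> A" "q \<in> A" using that(2,3) \<open>S \<subseteq> A\<close> by auto
      then show ?thesis
        using outcome[OF that False] mem[of \<sigma> p q] 2[OF supporters_subset[of n \<sigma> p q]] False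
          ranking_swap[OF profile_ranking[OF that(1) j], of p q] by simp
    qed
    then have "\<forall>\<sigma>\<in>profiles n A. Restr (F \<sigma>) S = (Restr (\<sigma> j) S)\<inverse>" by auto
    then show ?thesis unfolding dictator_on_def by blast
  qed
  then show ?thesis using j by blast
qed

subsection \<open>Blocks with two alternatives\<close>

text \<open>
  The required constitution on \<open>S\<close> extends a profile on \<open>S\<close> to one on \<open>A\<close> and restricts the outcome
  back to \<open>S\<close>; by IIA the choice of the extension does not matter.
\<close>

lemma contested_nonconstant:
  assumes "S \<subseteq> A" "a \<in> S" "b \<in> S" "a \<noteq> b" "(a, b) \<in> contested"
  shows "nonconstant_function_on n A F S"
proof -
  define res where "res \<sigma> = (\<lambda>i\<in>{1..n}. Restr (\<sigma> i) S)" for \<sigma> :: "nat \<Rightarrow> 'a rel"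
  have "\<exists>\<sigma>\<in>profiles n A. res \<sigma> = \<rho>" if \<rho>: "\<rho> \<in> profiles n S" for \<rho>
  proof -
    obtain \<sigma> where \<sigma>: "\<sigma> \<in> profiles n A" "\<forall>i\<in>{1..n}. Restr (\<sigma> i) S = \<rho> i"
      using profile_extension[of n \<rho> S A, OF profile_ranking[OF \<rho>] assms(1)] by blast
    have "\<rho> i = undefined" if "i \<notin> {1..n}" for i
      using \<rho> that unfolding profiles_def by (rule PiE_arb)
    then have "res \<sigma> i = \<rho> i" for i using \<sigma>(2) unfolding res_def restrict_def by auto
    then have "res \<sigma> = \<rho>" by (rule HOL.ext)
    with \<sigma>(1) show ?thesis by blast
  qed
  then obtain ext where ext: "\<And>\<rho>. \<rho> \<in> profiles n S \<Longrightarrow> ext \<rho> \<in> profiles n A \<and> res (ext \<rho>) = \<rho>"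
    by metis
  define G where "G = (\<lambda>\<rho>\<in>profiles n S. Restr (F (ext \<rho>)) S)"
  have res: "res \<sigma> \<in> profiles n S" if "\<sigma> \<in> profiles n A" for \<sigma>
    unfolding res_def using profile_restrict[OF that assms(1)] .
  have agree: "Restr (F \<sigma>) S = Restr (F \<tau>) S"
    if \<sigma>: "\<sigma> \<in> profiles n A" and \<tau>: "\<tau> \<in> profiles n A" and eq: "res \<sigma> = res \<tau>" for \<sigma> \<tau>
  proof -
    have same: "(p, q) \<in> \<sigma> i \<longleftrightarrow> (p, q) \<in> \<tau> i" if "p \<in> S" "q \<in> S" "i \<in> {1..n}" for p q i
    proof -
      have "Restr (\<sigma> i) S = Restr (\<tau> i) S"
        using fun_cong[OF eq, of i] that(3) by (simp add: res_def)
      then show ?thesis using that by blast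
    qed
    have "(p, q) \<in> F \<sigma> \<longleftrightarrow> (p, q) \<in> F \<tau>" if "p \<in> S" "q \<in> S" for p q
    proof (cases "p = q")
      case True
      then show ?thesis
        using tournament_irrefl[OF F_tournament[OF \<sigma>]] tournament_irrefl[OF F_tournament[OF \<tau>]] by blast
    next
      case False
      have "supporters n \<sigma> p q = supporters n \<tau> p q"
        unfolding supporters_def using same[OF that] by blast
      moreover have "p \<in> A" "q \<in> A" using that assms(1) by auto
      ultimately show ?thesis
        using outcome_pair_rule[OF \<sigma>] outcome_pair_rule[OF \<tau>] False by simp
    qed
    then show ?thesis by auto
  qed
  have G: "G (res \<sigma>) = Restr (F \<sigma>) S" if "\<sigma> \<in> profiles n A" for \<sigma>
  proof -
    have "G (res \<sigma>) = Restr (F (ext (res \<sigma>))) S" using res[OF that] by (simp add: G_def)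
    also have "\<dots> = Restr (F \<sigma>) S" using ext[OF res[OF that]] that by (intro agree) simp_all
    finally show ?thesis .
  qed
  have "G \<in> constitutions n S"
    using Restr_tournament[OF F_tournament assms(1)] ext by (auto simp: constitutions_def G_def)
  moreover have "\<forall>\<sigma>\<in>profiles n A. Restr (F \<sigma>) S = G (\<lambda>i\<in>{1..n}. Restr (\<sigma> i) S)"
    using G by (simp add: res_def)
  moreover have "\<exists>\<rho>\<in>profiles n S. \<exists>\<rho>'\<in>profiles n S. G \<rho> \<noteq> G \<rho>'"
  proof -
    obtain \<sigma> \<tau> where \<sigma>: "\<sigma> \<in> profiles n A" "(a, b) \<notin> F \<sigma>"
      and \<tau>: "\<tau> \<in> profiles n A" "(b, a) \<notin> F \<tau>"
      using assms(5) by (auto simp: contested_def always_above_def)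
    have "(a, b) \<in> F \<tau>"
      using tournament_swap[OF F_tournament[OF \<tau>(1)], of a b] \<tau>(2) assms(1-4) by auto
    then have "G (res \<sigma>) \<noteq> G (res \<tau>)"
      using G[OF \<sigma>(1)] G[OF \<tau>(1)] \<sigma>(2) assms(2,3) by auto
    then show ?thesis by (rule rev_bexI[OF res[OF \<sigma>(1)] rev_bexI[OF res[OF \<tau>(1)]]])
  qed
  ultimately show ?thesis unfolding nonconstant_function_on_def by (intro bexI[of _ G] conjI)
qed

end

section \<open>The classification\<close>

text \<open>
  Insertion sort. The relation \<open>always_above\<close> is not an order on all sets, since the empty set is above
  and below everything, so only properties relative to \<open>B\<close> are assumed.
\<close>

lemma list_of_totally_ordered_set:
  assumes "finite B"
    and "\<And>x y z. x \<in> B \<Longrightarrow> y \<in> B \<Longrightarrow> z \<in> B \<Longrightarrow> R x y \<Longrightarrow> R y z \<Longrightarrow> R x z"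
    and "\<And>x y. x \<in> B \<Longrightarrow> y \<in> B \<Longrightarrow> x \<noteq> y \<Longrightarrow> R x y \<or> R y x"
  shows "\<exists>xs. set xs = B \<and> distinct xs \<and> sorted_wrt R xs"
  using assms
proof (induction B rule: finite_induct)
  case (insert x B)
  have "\<exists>xs. set xs = B \<and> distinct xs \<and> sorted_wrt R xs"
  proof (rule insert.IH)
    show "R y w" if "y \<in> B" "z \<in> B" "w \<in> B" "R y z" "R z w" for y z w
      using insert.prems(1)[of y z w] that by simp
    show "R y z \<or> R z y" if "y \<in> B" "z \<in> B" "y \<noteq> z" for y z
      using insert.prems(2)[of y z] that by simp
  qed
  then obtain xs where xs: "set xs = B" "distinct xs" "sorted_wrt R xs" by blast
  have *: "R x z" if "z \<in> B" "\<not> R z x" for z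
    using insert.prems(2)[of x z] that insert.hyps(2) by auto
  have **: "R y z" if "y \<in> B" "z \<in> B" "R y x" "\<not> R z x" for y z
    using insert.prems(1)[of y x z] *[OF that(2,4)] that(1-3) by simp
  let ?ys = "filter (\<lambda>y. R y x) xs @ x # filter (\<lambda>y. \<not> R y x) xs"
  have "set ?ys = insert x B" using xs(1) by auto
  moreover have "distinct ?ys" using xs insert.hyps(2) by auto
  moreover have "sorted_wrt R ?ys"
    using xs * ** by (auto simp: sorted_wrt_append sorted_wrt_filter)
  ultimately show ?case by blast
qed simp

lemma arrow_class_block_decomposition:
  assumes "finite A" "F \<in> arrow_class n A"
  shows "\<exists>As. block_decomposition n A F As"
proof -
  interpret arrow_constitution n A F by unfold_locales (fact assms(2))
  let ?P = "A // contested"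
  have part: "partition_on A ?P" by (rule partition_on_quotient[OF equiv_contested])
  have "finite ?P"
    using finite_elements[OF assms(1) part] .
  then have "\<exists>As. set As = ?P \<and> distinct As \<and> sorted_wrt (always_above n A F) As"
  proof (rule list_of_totally_ordered_set)
    fix S T U
    assume "T \<in> ?P" and above: "always_above n A F S T" "always_above n A F T U"
    then have "T \<noteq> {}" using partition_onD3[OF part] by auto
    with above show "always_above n A F S U" by (rule always_above_trans)
  qed (rule blocks_comparable)
  then obtain As where As: "set As = ?P" "distinct As" "sorted_wrt (always_above n A F) As"
    by blast
  have "nonconstant_function_on n A F S" if S: "S \<in> ?P" and "card S = 2" for S
  proof -
    obtain a b where "S = {a, b}" "a \<noteq> b" using \<open>card S = 2\<close> by (auto simp: card_2_iff)
    moreover have "S \<subseteq> A" using S partition_onD1[OF part] by auto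
    ultimately show ?thesis
      using contested_nonconstant[of S a b] block_pair[OF S, of a b] by simp
  qed
  then have "block_decomposition n A F As"
    unfolding block_decomposition_def using As part large_block_dictator by simp
  then show ?thesis by blast
qed

lemma block_decomposition_arrow_class:
  assumes "F \<in> constitutions n A" "block_decomposition n A F As" "finite A"
  shows "F \<in> arrow_class n A"
proof -
  have part: "partition_on A (set As)"
    and sorted: "sorted_wrt (always_above n A F) As"
    and dict: "\<And>S. S \<in> set As \<Longrightarrow> card S \<ge> 3 \<Longrightarrow> \<exists>j\<in>{1..n}. dictator_on n A F S j"
    and nonc: "\<And>S. S \<in> set As \<Longrightarrow> card S = 2 \<Longrightarrow> nonconstant_function_on n A F S"
    using assms(2) unfolding block_decomposition_def by auto
  have F_tournament: "F \<sigma> \<in> tournaments A" if "\<sigma> \<in> profiles n A" for \<sigma>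
    using assms(1) that by (auto simp: constitutions_def)
  have block: "\<exists>s<length As. a \<in> As ! s" if "a \<in> A" for a
    using that unfolding partition_onD1[OF part] by (auto simp: in_set_conv_nth)
  have above: "(a, b) \<in> F \<sigma>"
    if "\<sigma> \<in> profiles n A" "s < t" "t < length As" "a \<in> As ! s" "b \<in> As ! t" for \<sigma> s t a b
    using sorted_wrt_nth_less[OF sorted that(2,3)] that by (auto simp: always_above_def)
  have S_sub: "As ! s \<subseteq> A" "finite (As ! s)" if "s < length As" for s
  proof -
    show "As ! s \<subseteq> A" using nth_mem[OF that] partition_onD1[OF part] by auto
    then show "finite (As ! s)" using assms(3) by (rule finite_subset)
  qed
  have "IIA n A F"
    unfolding IIA_def
  proof (intro ballI impI)
    fix a b \<sigma> \<tau>
    assume ab: "a \<in> A" "b \<in> A" "a \<noteq> b" and \<sigma>: "\<sigma> \<in> profiles n A" and \<tau>: "\<tau> \<in> profiles n A"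
      and same: "\<forall>i\<in>{1..n}. (a, b) \<in> \<sigma> i \<longleftrightarrow> (a, b) \<in> \<tau> i"
    obtain s t where s: "s < length As" "a \<in> As ! s" and t: "t < length As" "b \<in> As ! t"
      using block ab by blast
    have swap: "(b, a) \<in> F \<rho> \<longleftrightarrow> (a, b) \<notin> F \<rho>" if "\<rho> \<in> profiles n A" for \<rho>
      using tournament_swap[OF F_tournament[OF that] ab] .
    have same': "\<forall>i\<in>{1..n}. (b, a) \<in> \<sigma> i \<longleftrightarrow> (b, a) \<in> \<tau> i"
      using same ranking_swap[OF profile_ranking[OF \<sigma>] ab] ranking_swap[OF profile_ranking[OF \<tau>] ab]
      by simp
    consider "s < t" | "t < s" | "s = t" by linarith
    then show "(a, b) \<in> F \<sigma> \<longleftrightarrow> (a, b) \<in> F \<tau>"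
    proof cases
      case 1 then show ?thesis using above s t \<sigma> \<tau> by blast
    next
      case 2 then show ?thesis using above s t \<sigma> \<tau> swap by blast
    next
      case 3
      define S where "S = As ! s"
      have S: "S \<in> set As" "a \<in> S" "b \<in> S" "finite S" "S \<subseteq> A"
        using s t 3 S_sub by (auto simp: S_def)
      have restr: "(a, b) \<in> F \<rho> \<longleftrightarrow> (a, b) \<in> Restr (F \<rho>) S" for \<rho> using S(2,3) by blast
      have "card {a, b} \<le> card S" using S by (intro card_mono) auto
      then consider "card S \<ge> 3" | "card S = 2" using ab(3) by force
      then show ?thesis
      proof cases
        case 1
        then obtain j where j: "j \<in> {1..n}" "dictator_on n A F S j" using dict S(1) by blast
        from j(2) have "(\<forall>\<rho>\<in>profiles n A. (a, b) \<in> F \<rho> \<longleftrightarrow> (a, b) \<in> \<rho> j) \<or>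
            (\<forall>\<rho>\<in>profiles n A. (a, b) \<in> F \<rho> \<longleftrightarrow> (b, a) \<in> \<rho> j)"
          unfolding dictator_on_def restr using S(2,3) by auto
        then show ?thesis using same same' j(1) \<sigma> \<tau> by auto
      next
        case 2
        then have "S = {a, b}"
          using S(2-4) ab(3) by (intro card_subset_eq[symmetric]) auto
        obtain G where G: "\<And>\<rho>. \<rho> \<in> profiles n A \<Longrightarrow> Restr (F \<rho>) S = G (\<lambda>i\<in>{1..n}. Restr (\<rho> i) S)"
          using nonc[OF S(1) 2] unfolding nonconstant_function_on_def by blast
        have "Restr (\<sigma> i) S = Restr (\<tau> i) S" if i: "i \<in> {1..n}" for i
          using same same' i \<open>S = {a, b}\<close>
            ranking_irrefl[OF profile_ranking[OF \<sigma> i]]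
            ranking_irrefl[OF profile_ranking[OF \<tau> i]]
          by auto
        then have "(\<lambda>i\<in>{1..n}. Restr (\<sigma> i) S) = (\<lambda>i\<in>{1..n}. Restr (\<tau> i) S)"
          by (intro restrict_ext) auto
        then show ?thesis using G[OF \<sigma>] G[OF \<tau>] restr by metis
      qed
    qed
  qed
  moreover have "F \<sigma> \<in> rankings A" if \<sigma>: "\<sigma> \<in> profiles n A" for \<sigma>
  proof (rule transitive_tournament[OF F_tournament[OF \<sigma>]], rule transI)
    fix a b c
    assume ab: "(a, b) \<in> F \<sigma>" and bc: "(b, c) \<in> F \<sigma>"
    note T = F_tournament[OF \<sigma>]
    have A: "a \<in> A" "b \<in> A" "c \<in> A" using T ab bc by (auto simp: tournaments_def)
    have neq: "a \<noteq> b" "b \<noteq> c" using ab bc tournament_irrefl[OF T] by auto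
    have "a \<noteq> c" using ab bc tournament_swap[OF T A(1,2) neq(1)] by auto
    obtain s t u where s: "s < length As" "a \<in> As ! s" and t: "t < length As" "b \<in> As ! t"
      and u: "u < length As" "c \<in> As ! u"
      using block A by metis
    \<comment> \<open>The index of the block cannot decrease along an outcome preference.\<close>
    have mono: "p \<le> q" if "(x, y) \<in> F \<sigma>" "p < length As" "x \<in> As ! p" "q < length As" "y \<in> As ! q"
      for x y p q
    proof (rule ccontr)
      assume "\<not> p \<le> q"
      then have "(y, x) \<in> F \<sigma>" using above[OF \<sigma>, of q p y x] that by simp
      then show False using that(1) T by (auto simp: tournaments_def dest: asymD)
    qed
    have "s \<le> t" "t \<le> u" using mono ab bc s t u by blast+
    then consider "s < u" | "s = t" "t = u" by linarith
    then show "(a, c) \<in> F \<sigma>"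
    proof cases
      case 1 then show ?thesis using above \<sigma> s u by blast
    next
      case 2
      define S where "S = As ! s"
      have S: "S \<in> set As" "a \<in> S" "b \<in> S" "c \<in> S" "finite S"
        using s t u 2 S_sub by (auto simp: S_def)
      have "card {a, b, c} \<le> card S" using S by (intro card_mono) auto
      then have "card S \<ge> 3" using neq \<open>a \<noteq> c\<close> by simp
      then obtain j where j: "j \<in> {1..n}" "dictator_on n A F S j" using dict S(1) by blast
      have tr: "trans (\<sigma> j)" using rankings_trans profile_ranking[OF \<sigma> j(1)] by blast
      have "Restr (F \<sigma>) S = Restr (\<sigma> j) S \<or> Restr (F \<sigma>) S = (Restr (\<sigma> j) S)\<inverse>"
        using j(2) \<sigma> by (auto simp: dictator_on_def)
      then have "trans (Restr (F \<sigma>) S)" using trans_Restr[OF tr, of S] by (auto simp del: converse_Int)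
      moreover have "(a, b) \<in> Restr (F \<sigma>) S" "(b, c) \<in> Restr (F \<sigma>) S" using ab bc S(2-4) by auto
      ultimately have "(a, c) \<in> Restr (F \<sigma>) S" by (rule transD)
      then show ?thesis by simp
    qed
  qed
  ultimately show ?thesis
    using assms(1) by (auto simp: arrow_class_def transitivity_def)
qed

theorem theorem1p2:
  fixes A :: "'a set" and k n :: nat
  assumes "k \<ge> 3" and "n \<ge> 1" and "finite A" and "card A = k"
  shows "arrow_class n A = {F \<in> constitutions n A. \<exists>As. block_decomposition n A F As}"
proof (intro equalityI subsetI)
  fix F assume "F \<in> arrow_class n A"
  then show "F \<in> {F \<in> constitutions n A. \<exists>As. block_decomposition n A F As}"
    using arrow_class_block_decomposition[OF assms(3)] by (simp add: arrow_class_def)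
next
  fix F assume "F \<in> {F \<in> constitutions n A. \<exists>As. block_decomposition n A F As}"
  then show "F \<in> arrow_class n A"
    using block_decomposition_arrow_class assms(3) by blast
qed

end
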